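(* Let $X$ be a compact Riemann surface of genus $0$, isomorphic to $\mathbb{CP}^1$. Then every non-constant meromorphic function $f:X\to\mathbb{CP}^1$ has as many zeros as poles, where each is counted according to multiplicity.
   Context: A meromorphic function on $X$ is regarded as a holomorphic map $f:X\to\mathbb{CP}^1=\mathbb{C}\cup\{\infty\}$ not identically $\infty$. Isomorphic means biholomorphic. *)

theory Defs
  imports "HOL-Complex_Analysis.Complex_Analysis" "HOL-Homology.Homology"
begin

section \<open>Riemann surfaces and holomorphic maps\<close>

type_synonym 'a chart = "'a set \<times> ('a \<Rightarrow> complex)"

definition complex_chart :: "'a topology \<Rightarrow> 'a chart \<Rightarrow> bool" where
  "complex_chart X c \<longleftrightarrow> (case c of (U, \<phi>) \<Rightarrow>
     openin X U \<and> open (\<phi> ` U) \<and>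
     homeomorphic_map (subtopology X U) (top_of_set (\<phi> ` U)) \<phi>)"

text \<open>The atlas is not required to be maximal: none of the notions below changes when
  an atlas is replaced by a compatible one.\<close>

definition riemann_surface :: "'a topology \<Rightarrow> 'a chart set \<Rightarrow> bool" where
  "riemann_surface X A \<longleftrightarrow>
     topspace X \<noteq> {} \<and> connected_space X \<and> Hausdorff_space X \<and>
     (\<forall>c\<in>A. complex_chart X c) \<and>
     (\<Union>(U, \<phi>)\<in>A. U) = topspace X \<and>
     (\<forall>(U, \<phi>)\<in>A. \<forall>(V, \<psi>)\<in>A. (\<psi> \<circ> inv_into U \<phi>) holomorphic_on \<phi> ` (U \<inter> V))"

definition holomorphic_map ::
  "'a topology \<Rightarrow> 'a chart set \<Rightarrow> 'b topology \<Rightarrow> 'b chart set \<Rightarrow> ('a \<Rightarrow> 'b) \<Rightarrow> bool" where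
  "holomorphic_map X A Y B f \<longleftrightarrow>
     continuous_map X Y f \<and>
     (\<forall>(U, \<phi>)\<in>A. \<forall>(V, \<psi>)\<in>B.
        (\<psi> \<circ> f \<circ> inv_into U \<phi>) holomorphic_on \<phi> ` (U \<inter> f -` V))"

definition biholomorphic ::
  "'a topology \<Rightarrow> 'a chart set \<Rightarrow> 'b topology \<Rightarrow> 'b chart set \<Rightarrow> bool" where
  "biholomorphic X A Y B \<longleftrightarrow>
     (\<exists>f g. holomorphic_map X A Y B f \<and> holomorphic_map Y B X A g \<and>
        (\<forall>x\<in>topspace X. g (f x) = x) \<and> (\<forall>y\<in>topspace Y. f (g y) = y))"

text \<open>The first homology group of a compact Riemann surface of genus \<open>g\<close> is free abelian
  of rank \<open>2 * g\<close>, and this determines \<open>g\<close>.\<close>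

definition has_genus :: "'a topology \<Rightarrow> nat \<Rightarrow> bool" where
  "has_genus X g \<longleftrightarrow> homology_group 1 X \<cong> free_Abelian_group {..<2 * g}"


section \<open>The Riemann sphere\<close>

text \<open>The point at infinity is \<open>None\<close>.\<close>

definition riemann_sphere :: "complex option topology" where
  "riemann_sphere = Alexandroff_compactification euclidean"

text \<open>The two charts are \<open>z\<close> on the complex plane, and \<open>1 / z\<close> away from the origin,
  with value \<open>0\<close> at infinity.\<close>

definition riemann_sphere_atlas :: "complex option chart set" where
  "riemann_sphere_atlas =
     {(range Some, the), (UNIV - {Some 0}, case_option 0 inverse)}"

lemma topspace_riemann_sphere [simp]: "topspace riemann_sphere = UNIV"
  by (simp add: riemann_sphere_def UNIV_option_conv)

lemma openin_riemann_sphere: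
  "openin riemann_sphere V \<longleftrightarrow>
     (\<exists>U. open U \<and> V = Some ` U) \<or> (\<exists>C. compact C \<and> V = insert None (Some ` (- C)))"
  unfolding riemann_sphere_def openin_Alexandroff_compactification
  using compact_imp_closed by (auto simp: Compl_eq_Diff_UNIV)

lemma open_inverse_preimage:
  fixes W :: "complex set"
  assumes "open W"
  shows "open {z. z \<noteq> 0 \<and> inverse z \<in> W}"
proof -
  have "continuous_on (- {0}) (inverse :: complex \<Rightarrow> complex)"
    by (intro continuous_intros) auto
  then have "open (inverse -` W \<inter> - {0 :: complex})"
    using assms continuous_on_open_vimage[of "- {0 :: complex}" inverse] by auto
  moreover have "inverse -` W \<inter> - {0} = {z. z \<noteq> 0 \<and> inverse z \<in> W}"
    by auto
  ultimately show ?thesis by simp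
qed

lemma complex_chart_sphere_finite: "complex_chart riemann_sphere (range Some, the)"
proof -
  have "homeomorphic_map euclidean (subtopology riemann_sphere (range Some))
          (Some :: complex \<Rightarrow> complex option)"
    using embedding_map_Some[of "euclidean :: complex topology"]
    by (simp add: embedding_map_def riemann_sphere_def)
  then obtain g where g: "homeomorphic_maps euclidean (subtopology riemann_sphere (range Some))
      (Some :: complex \<Rightarrow> complex option) g"
    by (auto simp: homeomorphic_map_maps)
  then have "homeomorphic_map (subtopology riemann_sphere (range Some)) euclidean g"
    using homeomorphic_maps_sym homeomorphic_map_maps by blast
  moreover have "g x = the x" if "x \<in> range Some" for x
    using g that by (auto simp: homeomorphic_maps_def)
  ultimately have "homeomorphic_map (subtopology riemann_sphere (range Some)) euclidean
          (the :: complex option \<Rightarrow> complex)"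
    by (rule homeomorphic_map_eq) auto
  then show ?thesis
    by (auto simp: complex_chart_def image_image openin_riemann_sphere)
qed

lemma complex_chart_sphere_infinity:
  "complex_chart riemann_sphere (UNIV - {Some 0}, case_option 0 inverse)"
proof -
  let ?U = "UNIV - {Some 0} :: complex option set"
  let ?h = "case_option 0 inverse :: complex option \<Rightarrow> complex"
  let ?k = "\<lambda>w :: complex. if w = 0 then None else Some (inverse w)"
  have open_U: "openin riemann_sphere ?U"
  proof -
    have "?U = insert None (Some ` (- {0}))"
    proof -
      have "x \<in> ?U \<longleftrightarrow> x \<in> insert None (Some ` (- {0}))" for x
        by (cases x) auto
      then show ?thesis by blast
    qed
    moreover have "compact {0 :: complex}" by simp
    ultimately show ?thesis unfolding openin_riemann_sphere by blast
  qed
  have "openin riemann_sphere {x \<in> ?U. ?h x \<in> W}" if "open W" for W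
  proof (cases "0 \<in> W")
    case False
    have "{x \<in> ?U. ?h x \<in> W} = Some ` {z. z \<noteq> 0 \<and> inverse z \<in> W}"
      using False by (auto split: option.splits)
    then show ?thesis
      using open_inverse_preimage[OF that] unfolding openin_riemann_sphere by blast
  next
    case True
    define C where "C = - {z. z \<noteq> 0 \<and> inverse z \<in> W}"
    obtain e where e: "e > 0" "ball 0 e \<subseteq> W"
      using True \<open>open W\<close> open_contains_ball by blast
    have "norm z \<le> inverse e" if "z \<in> C" for z
    proof (rule ccontr)
      assume "\<not> norm z \<le> inverse e"
      then have gt: "inverse e < norm z" by simp
      then have "z \<noteq> 0" using e by (metis less_asym norm_zero positive_imp_inverse_positive)
      have "inverse (norm z) < e"
        using gt e by (metis inverse_inverse_eq less_imp_inverse_less positive_imp_inverse_positive)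
      then have "inverse z \<in> W" using e by (auto simp: norm_inverse)
      then show False using that \<open>z \<noteq> 0\<close> by (simp add: C_def)
    qed
    then have "bounded C" by (auto simp: bounded_iff)
    moreover have "closed C"
      using open_inverse_preimage[OF \<open>open W\<close>] by (simp add: C_def closed_def)
    ultimately have "compact C" by (simp add: compact_eq_bounded_closed)
    moreover have "x \<in> {x \<in> ?U. ?h x \<in> W} \<longleftrightarrow> x \<in> insert None (Some ` (- C))" for x
      using True by (cases x) (auto simp: C_def)
    then have "{x \<in> ?U. ?h x \<in> W} = insert None (Some ` (- C))"
      by blast
    ultimately show ?thesis unfolding openin_riemann_sphere by blast
  qed
  then have h: "continuous_map (subtopology riemann_sphere ?U) euclidean ?h"
    by (auto simp: continuous_map_def openin_open_subtopology[OF open_U] Pi_iff)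
  have "open {w. ?k w \<in> V}" if "openin riemann_sphere V" for V
    using that unfolding openin_riemann_sphere
  proof (elim disjE exE conjE)
    fix U assume "open U" "V = Some ` U"
    then have "{w. ?k w \<in> V} = {z. z \<noteq> 0 \<and> inverse z \<in> U}" by auto
    then show ?thesis using open_inverse_preimage[OF \<open>open U\<close>] by simp
  next
    fix C assume C: "compact C" "V = insert None (Some ` (- C))"
    obtain B where B: "B > 0" "\<And>z. z \<in> C \<Longrightarrow> norm z \<le> B"
      using compact_imp_bounded[OF C(1)] bounded_pos by blast
    have "w \<noteq> 0 \<Longrightarrow> norm w < inverse B \<Longrightarrow> inverse w \<notin> C" for w
      using B less_imp_inverse_less[of "norm w" "inverse B"]
      by (metis inverse_inverse_eq linorder_not_le norm_inverse zero_less_norm_iff)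
    then have "{w. ?k w \<in> V} = ball 0 (inverse B) \<union> {z. z \<noteq> 0 \<and> inverse z \<in> - C}"
      using B C by (auto simp: image_iff)
    moreover have "open (- C)" using compact_imp_closed[OF C(1)] by (simp add: open_Compl)
    ultimately show ?thesis
      using open_Un[OF open_ball open_inverse_preimage[of "- C"], of 0 "inverse B"] by simp
  qed
  then have "continuous_map euclidean riemann_sphere ?k"
    by (auto simp: continuous_map_def)
  then have k: "continuous_map euclidean (subtopology riemann_sphere ?U) ?k"
    by (auto simp: continuous_map_in_subtopology)
  have inv: "?h (?k w) = w" for w by simp
  have "homeomorphic_maps (subtopology riemann_sphere ?U) euclidean ?h ?k"
    using h k inv by (auto simp: homeomorphic_maps_def split: option.splits)
  then have hom: "homeomorphic_map (subtopology riemann_sphere ?U) euclidean ?h"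
    by (auto simp: homeomorphic_map_maps)
  then have "?h ` ?U = UNIV"
    using homeomorphic_imp_surjective_map[OF hom] by simp
  then show ?thesis using hom open_U by (simp add: complex_chart_def)
qed

lemma riemann_surface_riemann_sphere: "riemann_surface riemann_sphere riemann_sphere_atlas"
proof -
  let ?U = "UNIV - {Some 0} :: complex option set"
  let ?h = "case_option 0 inverse :: complex option \<Rightarrow> complex"
  have "connected_space riemann_sphere"
  proof -
    have "connectedin riemann_sphere (range Some)"
      using connectedin_continuous_map_image[OF continuous_map_Some[of euclidean],
          of "UNIV :: complex set"]
      by (simp add: riemann_sphere_def connected_UNIV)
    moreover have "riemann_sphere closure_of range Some = UNIV"
      using Alexandroff_compactification_dense[of "euclidean :: complex topology"]
      by (simp add: riemann_sphere_def compact_space_def UNIV_option_conv)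
    ultimately show ?thesis
      by (metis connectedin_closure_of connectedin_topspace topspace_riemann_sphere)
  qed
  moreover have "Hausdorff_space riemann_sphere"
    by (simp add: riemann_sphere_def Hausdorff_space_Alexandroff_compactification
        locally_compact_space_euclidean)
  moreover have "inj_on ?h ?U" by (auto simp: inj_on_def split: option.splits)
  then have inv_h: "inv_into ?U ?h w = Some (inverse w)" if "w \<noteq> 0" for w
    using that by (intro inv_into_f_eq) auto
  have inv_the: "inv_into (range Some) the w = Some w" for w :: complex
    by (intro inv_into_f_eq) (auto simp: inj_on_def)
  have "(?h \<circ> inv_into (range Some) the) holomorphic_on the ` (range Some \<inter> ?U)"
    by (simp add: o_def inv_the, intro holomorphic_intros) auto
  moreover have "(the \<circ> inv_into ?U ?h) holomorphic_on ?h ` (?U \<inter> range Some)"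
  proof (rule holomorphic_transform)
    show "inverse holomorphic_on ?h ` (?U \<inter> range Some)"
      by (intro holomorphic_intros) auto
    show "inverse w = (the \<circ> inv_into ?U ?h) w" if "w \<in> ?h ` (?U \<inter> range Some)" for w
    proof -
      have "w \<noteq> 0" using that by auto
      then show ?thesis by (simp add: inv_h)
    qed
  qed
  moreover have "(the \<circ> inv_into (range Some) the) holomorphic_on the ` (range Some \<inter> range Some)"
    by (simp add: o_def inv_the)
  moreover have "(?h \<circ> inv_into ?U ?h) holomorphic_on ?h ` (?U \<inter> ?U)"
    by (rule holomorphic_transform[of id]) (auto simp: f_inv_into_f)
  ultimately show ?thesis
    using complex_chart_sphere_finite complex_chart_sphere_infinity
    by (auto simp: riemann_surface_def riemann_sphere_atlas_def UNIV_option_conv)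
qed


section \<open>Meromorphic functions, zeros and poles\<close>

definition meromorphic_function ::
  "'a topology \<Rightarrow> 'a chart set \<Rightarrow> ('a \<Rightarrow> complex option) \<Rightarrow> bool" where
  "meromorphic_function X A f \<longleftrightarrow>
     holomorphic_map X A riemann_sphere riemann_sphere_atlas f \<and>
     (\<exists>x\<in>topspace X. f x \<noteq> None)"

definition zeros :: "'a topology \<Rightarrow> ('a \<Rightarrow> complex option) \<Rightarrow> 'a set" where
  "zeros X f = {x \<in> topspace X. f x = Some 0}"

definition poles :: "'a topology \<Rightarrow> ('a \<Rightarrow> complex option) \<Rightarrow> 'a set" where
  "poles X f = {x \<in> topspace X. f x = None}"

text \<open>The order of \<open>f\<close> at \<open>p\<close> is the exponent of the leading term of the Laurent expansion
  of \<open>f\<close> in a local coordinate around \<open>p\<close>; it is the same in every chart.  Whether \<open>f\<close> is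
  infinite at \<open>p\<close> itself does not matter for the value of \<^const>\<open>zorder\<close>, which only depends
  on a punctured neighbourhood.\<close>

definition meromorphic_order ::
  "'a chart set \<Rightarrow> ('a \<Rightarrow> complex option) \<Rightarrow> 'a \<Rightarrow> int" where
  "meromorphic_order A f p =
     (THE n. \<forall>(U, \<phi>)\<in>A. p \<in> U \<longrightarrow> n = zorder (the \<circ> f \<circ> inv_into U \<phi>) (\<phi> p))"

definition zero_multiplicity ::
  "'a chart set \<Rightarrow> ('a \<Rightarrow> complex option) \<Rightarrow> 'a \<Rightarrow> nat" where
  "zero_multiplicity A f p = nat (meromorphic_order A f p)"

definition pole_multiplicity ::
  "'a chart set \<Rightarrow> ('a \<Rightarrow> complex option) \<Rightarrow> 'a \<Rightarrow> nat" where
  "pole_multiplicity A f p = nat (- meromorphic_order A f p)"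

end

theory Submission
  imports Defs
begin

text \<open>A biholomorphic map \<open>F\<close> from \<open>X\<close> to the sphere, with inverse \<open>G\<close>, turns \<open>f\<close> into the
  meromorphic function \<open>f \<circ> G\<close> on the sphere.  Composition with an injective holomorphic map does
  not change the order of a meromorphic function at a point
  (\<open>zorder_compose_injective\<close>).  This shows both that the order of \<open>f\<close> at a point is the same in
  every chart and that it can be read off from \<open>f \<circ> G\<close> in one of the two charts of the sphere
  (\<open>meromorphic_order_eq_zorder\<close>).  The orders are positive exactly at the zeros and negative
  exactly at the poles, so the claim is that there are finitely many points of nonzero order and
  that the orders on the sphere add up to \<open>0\<close>.

  In the plane, \<open>f \<circ> G\<close> is a meromorphic function \<open>k\<close> that is also meromorphic at infinity.  The
  exceptional points are isolated in the plane and isolated from infinity, so there are only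
  finitely many.  Divide \<open>k\<close> by the finite product of the \<open>(z - a) powi n\<^sub>a\<close>, where \<open>n\<^sub>a\<close> is
  the order of \<open>k\<close> at \<open>a\<close>.  The quotient extends to an entire function \<open>h\<close> without zeros.  If \<open>h\<close>
  had positive order at infinity, then it would tend to \<open>0\<close> there and vanish by Liouville's theorem;
  if the order were negative, then the same would apply to \<open>1 / h\<close>.  So \<open>h\<close> has order \<open>0\<close> at infinity
  (\<open>zorder_at_infinity_entire_nonvanishing\<close>), which says that the order of \<open>k\<close> at infinity is minus
  the sum of the \<open>n\<^sub>a\<close> (\<open>sum_zorder_extended_plane\<close>).\<close>

section \<open>Meromorphic functions on the extended plane\<close>

text \<open>Near infinity, a function \<open>k\<close> on the plane is studied through \<open>k (inverse w)\<close> near \<open>w = 0\<close>.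
  The value at \<open>w = 0\<close> itself is irrelevant, as limits, meromorphy and \<open>zorder\<close> at \<open>0\<close> only see
  a punctured neighbourhood.\<close>

lemma zorder_eq_0_imp_remove_sings_analytic_nonzero:
  assumes "f meromorphic_on {z}" "frequently (\<lambda>w. f w \<noteq> 0) (at z)" "zorder f z = 0"
  shows "remove_sings f analytic_on {z}" "remove_sings f z \<noteq> 0"
proof -
  have iso: "isolated_singularity_at f z" "not_essential f z"
    using assms(1) by (simp_all add: meromorphic_at_iff)
  have np: "\<not> is_pole f z"
    using isolated_pole_imp_neg_zorder[OF iso(1)] assms(3) by fastforce
  have "\<not> isolated_zero f z"
    using zorder_isolated_zero_pos'[of f z] iso assms(3) by fastforce
  show "remove_sings f analytic_on {z}"
    using iso np not_essential_def remove_sings_analytic_at by blast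
  show "remove_sings f z \<noteq> 0"
    using np \<open>\<not> isolated_zero f z\<close> iso assms(2)
      isolated_zero_def non_zero_neighbour remove_sings_eq_0_iff by blast
qed

lemma tendsto_at_infinity_inverse:
  fixes h :: "complex \<Rightarrow> complex"
  shows "((\<lambda>w. h (inverse w)) \<longlongrightarrow> l) (at 0) \<Longrightarrow> (h \<longlongrightarrow> l) at_infinity"
  unfolding at_to_infinity filterlim_filtermap by simp

lemma zorder_at_infinity_entire_nonvanishing:
  assumes hol: "h holomorphic_on UNIV" and nz: "\<And>z. h z \<noteq> 0"
    and mero: "(\<lambda>w. h (inverse w)) meromorphic_on {0}"
  shows "zorder (\<lambda>w. h (inverse w)) 0 = 0"
proof -
  have ev: "eventually (\<lambda>w. h (inverse w) \<noteq> 0) (at 0)"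
    using nz by simp
  have "\<not> zorder (\<lambda>w. h (inverse w)) 0 > 0"
  proof
    assume "zorder (\<lambda>w. h (inverse w)) 0 > 0"
    then have "isolated_zero (\<lambda>w. h (inverse w)) 0"
      by (rule zorder_pos_imp_isolated_zero[OF mero ev])
    then have "((\<lambda>w. h (inverse w)) \<longlongrightarrow> 0) (at 0)"
      unfolding isolated_zero_def by (rule conjunct1)
    then have "(h \<longlongrightarrow> 0) at_infinity"
      by (rule tendsto_at_infinity_inverse)
    then show False
      using Liouville_weak_0[OF hol, of 0] nz[of 0] by simp
  qed
  moreover have "\<not> zorder (\<lambda>w. h (inverse w)) 0 < 0"
  proof
    assume "zorder (\<lambda>w. h (inverse w)) 0 < 0"
    then have "is_pole (\<lambda>w. h (inverse w)) 0"
      by (rule zorder_neg_imp_is_pole[OF mero ev])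
    then have "isolated_zero (\<lambda>w. inverse (h (inverse w))) 0"
      by (rule is_pole_imp_isolated_zero_inverse)
    then have "((\<lambda>w. inverse (h (inverse w))) \<longlongrightarrow> 0) (at 0)"
      unfolding isolated_zero_def by (rule conjunct1)
    then have "((\<lambda>z. inverse (h z)) \<longlongrightarrow> 0) at_infinity"
      by (rule tendsto_at_infinity_inverse[of "\<lambda>z. inverse (h z)"])
    moreover have "(\<lambda>z. inverse (h z)) holomorphic_on UNIV"
      using holomorphic_on_inverse[OF hol] nz by simp
    ultimately have "inverse (h 0) = 0"
      by (intro Liouville_weak_0[of "\<lambda>z. inverse (h z)"])
    then show False
      using nz[of 0] by simp
  qed
  ultimately show ?thesis by simp
qed

lemma zorder_linear_powi:
  "zorder (\<lambda>z. (z - a) powi n) z = (if z = a then n else 0)"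
proof (cases "z = a")
  case True
  then show ?thesis
    by (auto intro!: zorder_eqI[of UNIV _ "\<lambda>_. 1"])
next
  case False
  have "(\<lambda>z. (z - a) powi n) analytic_on {z}"
    using False by (intro analytic_intros) auto
  then show ?thesis
    using False by (auto intro!: zorder_eq_0I)
qed

lemma zorder_inverse_linear_powi:
  "zorder (\<lambda>w. (inverse w - a) powi n) 0 = - n"
proof (rule zorder_eqI[of "{w. 1 - a * w \<noteq> 0}" _ "\<lambda>w. (1 - a * w) powi n"])
  show "open {w. 1 - a * w \<noteq> 0}"
    by (intro open_Collect_neq continuous_intros)
  show "(\<lambda>w. (1 - a * w) powi n) holomorphic_on {w. 1 - a * w \<noteq> 0}"
    by (intro holomorphic_intros) auto
  fix w :: complex
  assume "w \<noteq> 0"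
  then have "inverse w - a = (1 - a * w) * inverse w"
    by (simp add: field_simps)
  then show "(inverse w - a) powi n = (1 - a * w) powi n * (w - 0) powi - n"
    by (simp only: power_int_mult_distrib power_int_inverse power_int_minus diff_zero)
qed auto

lemma meromorphic_on_extended_plane:
  assumes mero: "k meromorphic_on UNIV" and inf: "(\<lambda>w. k (inverse w)) meromorphic_on {0}"
  shows "(\<lambda>w. k (inverse w)) meromorphic_on UNIV"
proof -
  have "(\<lambda>w. k (inverse w)) meromorphic_on - {0}"
    by (rule meromorphic_on_compose[OF mero]) (auto intro!: analytic_intros)
  then show ?thesis
    using meromorphic_on_Un[OF _ inf, of "- {0}"] by (metis Compl_partition2)
qed

lemma eventually_at_infinity_inverse:
  fixes P :: "complex \<Rightarrow> bool"
  shows "eventually P at_infinity \<longleftrightarrow> eventually (\<lambda>w. P (inverse w)) (at 0)"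
  unfolding at_to_infinity eventually_filtermap by simp

lemma eventually_analytic_at_infinity:
  assumes mero: "k meromorphic_on UNIV" and inf: "(\<lambda>w. k (inverse w)) meromorphic_on {0}"
  shows "eventually (\<lambda>z. k analytic_on {z}) at_infinity"
proof -
  have "\<forall>\<^sub>\<approx>w\<in>UNIV. (\<lambda>w. k (inverse w)) analytic_on {w}"
    by (rule meromorphic_on_imp_analytic_cosparse[OF meromorphic_on_extended_plane[OF assms]])
  then have "eventually (\<lambda>w. (\<lambda>w. k (inverse w)) analytic_on {w}) (at 0)"
    by (simp add: eventually_cosparse_open_eq)
  then have "eventually (\<lambda>w. k analytic_on {inverse w}) (at 0)"
    using eventually_neq_at_within[of 0]
  proof eventually_elim
    case (elim w)
    then have "(\<lambda>w. k (inverse w)) \<circ> inverse analytic_on {inverse w}"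
      by (intro analytic_on_compose) (auto intro!: analytic_intros)
    then show ?case by (simp add: o_def)
  qed
  then show ?thesis by (simp add: eventually_at_infinity_inverse)
qed

text \<open>If \<open>k (inverse w)\<close> were zero on a punctured neighbourhood of \<open>0\<close>, the identity theorem would
  make it zero almost everywhere in the plane, in particular near \<open>1\<close>, where inversion carries
  this over to \<open>k\<close>.\<close>

lemma eventually_nonzero_at_infinity:
  assumes mero: "k meromorphic_on UNIV" and inf: "(\<lambda>w. k (inverse w)) meromorphic_on {0}"
    and nz: "\<forall>\<^sub>\<approx>z\<in>UNIV. k z \<noteq> 0"
  shows "eventually (\<lambda>z. k z \<noteq> 0) at_infinity"
proof -
  note K = meromorphic_on_extended_plane[OF mero inf]
  have "\<not> (\<forall>\<^sub>\<approx>w\<in>UNIV. k (inverse w) = 0)"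
  proof
    assume "\<forall>\<^sub>\<approx>w\<in>UNIV. k (inverse w) = 0"
    then have ev: "eventually (\<lambda>w. k (inverse w) = 0) (at 1)"
      by (simp add: eventually_cosparse_open_eq)
    have "filterlim inverse (at 1) (at (1::complex))"
    proof (rule filterlim_atI)
      show "(inverse \<longlongrightarrow> 1) (at (1::complex))"
        by (rule tendsto_eq_intros | simp)+
      show "eventually (\<lambda>x. inverse x \<noteq> (1::complex)) (at 1)"
        by (rule eventually_mono[OF eventually_neq_at_within[of 1]]) auto
    qed
    then have "eventually (\<lambda>z. k (inverse (inverse z)) = 0) (at 1)"
      by (rule eventually_compose_filterlim[OF ev])
    moreover have "eventually (\<lambda>z. k z \<noteq> 0) (at 1)"
      using nz by (simp add: eventually_cosparse_open_eq)
    ultimately have "eventually (\<lambda>z::complex. False) (at 1)"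
      by eventually_elim simp
    then show False by simp
  qed
  then have "\<forall>\<^sub>\<approx>w\<in>UNIV. k (inverse w) \<noteq> 0"
    using meromorphic_imp_constant_or_avoid[OF K, of 0] by auto
  then show ?thesis
    by (simp add: eventually_at_infinity_inverse eventually_cosparse_open_eq)
qed

lemma finite_zorder_nonzero:
  assumes mero: "k meromorphic_on UNIV" and inf: "(\<lambda>w. k (inverse w)) meromorphic_on {0}"
    and nz: "\<forall>\<^sub>\<approx>z\<in>UNIV. k z \<noteq> 0"
  shows "finite {z. zorder k z \<noteq> 0}"
proof -
  let ?S = "{z. zorder k z \<noteq> 0}"
  have ord0: "zorder k z = 0" if "k analytic_on {z}" "k z \<noteq> 0" for z
    using that by (rule zorder_eq_0I)
  have "\<forall>\<^sub>\<approx>z\<in>UNIV. k analytic_on {z}"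
    by (rule meromorphic_on_imp_analytic_cosparse[OF mero])
  then have "\<forall>\<^sub>\<approx>z\<in>UNIV. zorder k z = 0"
    using nz by eventually_elim (rule ord0)
  then have sparse: "?S sparse_in UNIV"
    by (simp add: eventually_cosparse)
  have "eventually (\<lambda>z. zorder k z = 0) at_infinity"
    using eventually_analytic_at_infinity[OF mero inf] eventually_nonzero_at_infinity[OF assms]
    by eventually_elim (rule ord0)
  then obtain b where "\<And>z. norm z \<ge> b \<Longrightarrow> zorder k z = 0"
    by (auto simp: eventually_at_infinity)
  then have "norm z \<le> b" if "z \<in> ?S" for z
    using that linear by blast
  then have "?S = cball 0 b \<inter> ?S" by auto
  moreover have "finite (cball 0 b \<inter> ?S)"
    by (rule sparse_in_compact_finite) (use sparse_in_subset[OF sparse] in auto)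
  ultimately show ?thesis by simp
qed

text \<open>The orders of a meromorphic function on the extended plane add up to zero.\<close>

theorem sum_zorder_extended_plane:
  assumes mero: "k meromorphic_on UNIV" and inf: "(\<lambda>w. k (inverse w)) meromorphic_on {0}"
    and nz: "\<forall>\<^sub>\<approx>z\<in>UNIV. k z \<noteq> 0"
  shows "(\<Sum>z | zorder k z \<noteq> 0. zorder k z) + zorder (\<lambda>w. k (inverse w)) 0 = 0"
proof -
  define S where "S = {z. zorder k z \<noteq> 0}"
  have "finite S"
    unfolding S_def by (rule finite_zorder_nonzero[OF assms])
  define P where "P = (\<lambda>z. \<Prod>a\<in>S. (z - a) powi zorder k a)"
  define G where "G = (\<lambda>z. k z / P z)"
  define h where "h = remove_sings G"
  have nz_at: "eventually (\<lambda>w. k w \<noteq> 0) (at z)" for z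
    using nz by (simp add: eventually_cosparse_open_eq)
  have P_mero: "P meromorphic_on B" for B
    unfolding P_def by (intro meromorphic_intros)
  have "eventually (\<lambda>w. w \<notin> S) (at z)" for z
    using \<open>finite S\<close> islimpt_finite islimpt_iff_eventually by blast
  then have P_nz: "eventually (\<lambda>w. P w \<noteq> 0) (at z)" for z
    by (rule eventually_mono) (auto simp: P_def \<open>finite S\<close>)
  have P_ord: "zorder P z = zorder k z" for z
  proof -
    have "zorder P z = (\<Sum>a\<in>S. zorder (\<lambda>z. (z - a) powi zorder k a) z)"
      unfolding P_def
    proof (rule zorder_prod)
      show "(\<lambda>z. (z - a) powi zorder k a) meromorphic_on {z}" for a
        by (intro meromorphic_intros)
    qed (use P_nz[of z] in \<open>simp add: P_def\<close>)
    also have "\<dots> = (\<Sum>a\<in>S. if z = a then zorder k a else 0)"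
      by (simp add: zorder_linear_powi)
    also have "\<dots> = zorder k z"
      using \<open>finite S\<close> by (simp add: S_def)
    finally show ?thesis .
  qed
  have freq: "frequently Q (at z)" if "eventually Q (at z)" for Q and z :: complex
    using that by (simp add: eventually_frequently)
  have k_mero: "k meromorphic_on B" for B
    using mero by (rule meromorphic_on_subset) auto
  have G_mero: "G meromorphic_on B" for B
    unfolding G_def by (intro meromorphic_intros k_mero P_mero)
  have G_nz: "frequently (\<lambda>w. G w \<noteq> 0) (at z)" for z
  proof (rule freq)
    show "eventually (\<lambda>w. G w \<noteq> 0) (at z)"
      using nz_at[of z] P_nz[of z] by eventually_elim (simp add: G_def)
  qed
  have "zorder G z = 0" for z
    unfolding G_def using zorder_divide[OF k_mero freq[OF nz_at] P_mero freq[OF P_nz], of z]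
    by (simp add: P_ord)
  then have h: "h analytic_on {z}" "h z \<noteq> 0" for z
    using zorder_eq_0_imp_remove_sings_analytic_nonzero[OF G_mero G_nz] by (simp_all add: h_def)
  have h_hol: "h holomorphic_on UNIV"
    using h(1) analytic_on_analytic_at analytic_imp_holomorphic by blast

  have P_inf_mero: "(\<lambda>w. P (inverse w)) meromorphic_on {0}"
    unfolding P_def by (intro meromorphic_intros)
  have "eventually (\<lambda>z. z \<notin> S) at_infinity"
  proof -
    obtain b where b: "\<And>z. z \<in> S \<Longrightarrow> norm z \<le> b"
      using finite_imp_bounded[OF \<open>finite S\<close>] by (auto simp: bounded_iff)
    have "z \<notin> S" if "norm z \<ge> b + 1" for z
      using b[of z] that by auto
    then show ?thesis
      by (auto simp: eventually_at_infinity)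
  qed
  then have "eventually (\<lambda>z. P z \<noteq> 0) at_infinity"
    by (rule eventually_mono) (auto simp: P_def \<open>finite S\<close>)
  then have P_inf_nz: "eventually (\<lambda>w. P (inverse w) \<noteq> 0) (at 0)"
    by (simp add: eventually_at_infinity_inverse)
  have P_inf: "zorder (\<lambda>w. P (inverse w)) 0 = - (\<Sum>a\<in>S. zorder k a)"
  proof -
    have "zorder (\<lambda>w. P (inverse w)) 0
        = (\<Sum>a\<in>S. zorder (\<lambda>w. (inverse w - a) powi zorder k a) 0)"
      unfolding P_def
    proof (rule zorder_prod)
      show "(\<lambda>w. (inverse w - a) powi zorder k a) meromorphic_on {0}" for a
        by (intro meromorphic_intros)
    qed (use P_inf_nz in \<open>simp add: P_def\<close>)
    then show ?thesis
      by (simp add: zorder_inverse_linear_powi sum_negf)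
  qed
  have k_inf_nz: "eventually (\<lambda>w. k (inverse w) \<noteq> 0) (at 0)"
    using eventually_nonzero_at_infinity[OF assms] by (simp add: eventually_at_infinity_inverse)
  have G_inf: "(\<lambda>w. G (inverse w)) meromorphic_on {0}"
    unfolding G_def by (intro meromorphic_intros inf P_inf_mero)
  have "zorder (\<lambda>w. G (inverse w)) 0 = zorder (\<lambda>w. k (inverse w)) 0 + (\<Sum>a\<in>S. zorder k a)"
    unfolding G_def using zorder_divide[OF inf freq[OF k_inf_nz] P_inf_mero freq[OF P_inf_nz]]
    by (simp add: P_inf)
  moreover have "zorder (\<lambda>w. G (inverse w)) 0 = 0"
  proof -
    have "eventually (\<lambda>z. h z = G z) at_infinity"
      using eventually_analytic_at_infinity[OF G_mero G_inf] by eventually_elim (simp add: h_def)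
    then have hG: "eventually (\<lambda>w. h (inverse w) = G (inverse w)) (at 0)"
      unfolding eventually_at_infinity_inverse .
    then have hG': "eventually (\<lambda>w. h (inverse w) = G (inverse w)) (at z)" if "z \<in> {0}" for z
      using that by (metis singletonD)
    have "(\<lambda>w. h (inverse w)) meromorphic_on {0}"
      by (rule iffD2[OF meromorphic_on_cong[OF hG' refl] G_inf])
    then have "zorder (\<lambda>w. h (inverse w)) 0 = 0"
      by (rule zorder_at_infinity_entire_nonvanishing[OF h_hol h(2)])
    then show ?thesis
      using zorder_cong[OF hG refl] by metis
  qed
  ultimately show ?thesis
    unfolding S_def by linarith
qed

section \<open>Orders and holomorphic maps in charts\<close>

lemma zorder_compose_injective:
  assumes f: "f meromorphic_on {g z}" and g: "g holomorphic_on S" "inj_on g S" "open S" "z \<in> S"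
  shows "zorder (f \<circ> g) z = zorder f (g z)"
proof -
  have g_an: "g analytic_on {z}"
    using g analytic_at by blast
  have ne: "eventually (\<lambda>w. g w \<noteq> g z) (at z)"
  proof -
    have "eventually (\<lambda>w. w \<in> S - {z}) (at z)"
      using g by (intro eventually_at_in_open) auto
    then show ?thesis
      by eventually_elim (use g in \<open>auto simp: inj_on_def\<close>)
  qed
  \<comment> \<open>Where \<open>f\<close> vanishes identically, \<open>zorder\<close> is an unspecified value, but one that does not
    depend on the point.\<close>
  show ?thesis
  proof (cases "eventually (\<lambda>w. f w = 0) (at (g z))")
    case True
    have "filterlim g (at (g z)) (at z)"
      using ne analytic_at_imp_isCont[OF g_an] by (simp add: filterlim_at isCont_def)
    then have "eventually (\<lambda>w. (f \<circ> g) w = 0) (at z)"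
      using eventually_compose_filterlim[OF True] by simp
    then have "zorder (f \<circ> g) z = zorder (\<lambda>_. 0) z"
      by (rule zorder_cong) simp
    also have "\<dots> = zorder (\<lambda>_. 0) (g z)"
      by (simp add: zorder_shift')
    also have "\<dots> = zorder f (g z)"
      using True by (intro zorder_cong) (auto elim: eventually_mono)
    finally show ?thesis .
  next
    case False
    have iso: "isolated_singularity_at f (g z)" "not_essential f (g z)"
      using f by (simp_all add: meromorphic_at_iff)
    then have nz: "eventually (\<lambda>w. f w \<noteq> 0) (at (g z))"
      using False by (intro non_zero_neighbour) (simp_all add: frequently_def)
    have "zorder (\<lambda>x. g x - g z) z = 1"
    proof (rule zorder_zero_eqI')
      show "(\<lambda>x. g x - g z) analytic_on {z}"
        using g_an by (intro analytic_intros)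
      have "(\<lambda>x. g x - g z) field_differentiable at z" "g field_differentiable at z"
        using \<open>(\<lambda>x. g x - g z) analytic_on {z}\<close> g_an analytic_on_imp_differentiable_at by blast+
      then have "deriv (\<lambda>x. g x - g z) z = deriv g z"
        by simp
      then show "(deriv ^^ nat 1) (\<lambda>x. g x - g z) z \<noteq> 0"
        using holomorphic_injective_imp_regular[OF g(1) g(3) g(2) g(4)] by simp
    qed auto
    then show ?thesis
      using zorder_compose'[OF iso g_an nz ne] by simp
  qed
qed

lemma complex_chartD:
  assumes "complex_chart X (U, \<phi>)"
  shows "openin X U" "U \<subseteq> topspace X" "inj_on \<phi> U"
    "\<And>W. openin X W \<Longrightarrow> W \<subseteq> U \<Longrightarrow> open (\<phi> ` W)"
proof -
  show U: "openin X U" and "U \<subseteq> topspace X"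
    using assms openin_subset by (auto simp: complex_chart_def)
  have hom: "homeomorphic_map (subtopology X U) (top_of_set (\<phi> ` U)) \<phi>" and op: "open (\<phi> ` U)"
    using assms by (auto simp: complex_chart_def)
  show "inj_on \<phi> U"
    using homeomorphic_imp_injective_map[OF hom] \<open>U \<subseteq> topspace X\<close>
    by (simp add: Int_absorb1 topspace_subtopology)
  fix W assume W: "openin X W" "W \<subseteq> U"
  then have "openin (subtopology X U) W"
    using U by (simp add: openin_open_subtopology)
  then have "openin (top_of_set (\<phi> ` U)) (\<phi> ` W)"
    using homeomorphic_imp_open_map[OF hom] by (simp add: open_map_def)
  then show "open (\<phi> ` W)"
    using op by (simp add: openin_open_eq)
qed

lemma riemann_surface_chart:
  assumes "riemann_surface X A"
  shows "(U, \<phi>) \<in> A \<Longrightarrow> complex_chart X (U, \<phi>)"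
    and "p \<in> topspace X \<Longrightarrow> \<exists>U \<phi>. (U, \<phi>) \<in> A \<and> p \<in> U"
proof -
  show "complex_chart X (U, \<phi>)" if "(U, \<phi>) \<in> A"
    using assms that by (auto simp: riemann_surface_def)
  have "(\<Union>(U, \<phi>)\<in>A. U) = topspace X"
    using assms by (simp add: riemann_surface_def)
  then show "\<exists>U \<phi>. (U, \<phi>) \<in> A \<and> p \<in> U" if "p \<in> topspace X"
    using that by blast
qed

lemma holomorphic_map_in_charts:
  assumes X: "riemann_surface X A" and Y: "riemann_surface Y B"
    and F: "holomorphic_map X A Y B F"
    and charts: "(U, \<phi>) \<in> A" "(V, \<psi>) \<in> B"
  shows "open (\<phi> ` (U \<inter> F -` V))"
    and "(\<psi> \<circ> F \<circ> inv_into U \<phi>) holomorphic_on \<phi> ` (U \<inter> F -` V)"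
proof -
  note chX = complex_chartD[OF riemann_surface_chart(1)[OF X charts(1)]]
  note chY = complex_chartD[OF riemann_surface_chart(1)[OF Y charts(2)]]
  have "openin X {x \<in> topspace X. F x \<in> V}"
    using F chY(1) by (auto simp: holomorphic_map_def intro: openin_continuous_map_preimage)
  then have "openin X (U \<inter> {x \<in> topspace X. F x \<in> V})"
    using chX(1) by blast
  moreover have "U \<inter> {x \<in> topspace X. F x \<in> V} = U \<inter> F -` V"
    using chX(2) by auto
  ultimately show "open (\<phi> ` (U \<inter> F -` V))"
    using chX(4) by auto
  show "(\<psi> \<circ> F \<circ> inv_into U \<phi>) holomorphic_on \<phi> ` (U \<inter> F -` V)"
    using F charts by (auto simp: holomorphic_map_def)
qed

lemma holomorphic_map_compose:
  assumes X: "riemann_surface X A" and Y: "riemann_surface Y B" and Z: "riemann_surface Z C"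
    and F: "holomorphic_map X A Y B F" and G: "holomorphic_map Y B Z C G"
  shows "holomorphic_map X A Z C (G \<circ> F)"
  unfolding holomorphic_map_def
proof (intro conjI ballI, safe)
  show "continuous_map X Z (G \<circ> F)"
    using F G continuous_map_compose by (auto simp: holomorphic_map_def)
  fix U \<phi> W \<xi>
  assume c: "(U, \<phi>) \<in> A" "(W, \<xi>) \<in> C"
  note chX = complex_chartD[OF riemann_surface_chart(1)[OF X c(1)]]
  have "(\<xi> \<circ> (G \<circ> F) \<circ> inv_into U \<phi>) analytic_on {\<phi> p}"
    if p: "p \<in> U" "G (F p) \<in> W" for p
  proof -
    have "F p \<in> topspace Y"
      using F p chX(2) by (auto simp: holomorphic_map_def continuous_map_def)
    then obtain V \<psi> where V: "(V, \<psi>) \<in> B" "F p \<in> V"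
      using riemann_surface_chart(2)[OF Y] by blast
    note chY = complex_chartD[OF riemann_surface_chart(1)[OF Y V(1)]]
    let ?S = "\<phi> ` (U \<inter> F -` V)" and ?T = "\<psi> ` (V \<inter> G -` W)"
    let ?f = "\<psi> \<circ> F \<circ> inv_into U \<phi>" and ?g = "\<xi> \<circ> G \<circ> inv_into V \<psi>"
    note f = holomorphic_map_in_charts[OF X Y F c(1) V(1)]
    note g = holomorphic_map_in_charts[OF Y Z G V(1) c(2)]
    have inv: "inv_into U \<phi> (\<phi> p) = p"
      using chX(3) p by simp
    have "?f analytic_on {\<phi> p}"
      using f p V(2) analytic_at by blast
    moreover have "?g analytic_on ?f ` {\<phi> p}"
      using g p V(2) inv by (auto simp: analytic_at)
    ultimately have an: "(?g \<circ> ?f) analytic_on {\<phi> p}"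
      by (rule analytic_on_compose)
    have "eventually (\<lambda>w. w \<in> ?S) (nhds (\<phi> p))"
      using f(1) p V(2) by (intro eventually_nhds_in_open) auto
    then have "eventually (\<lambda>w. (?g \<circ> ?f) w = (\<xi> \<circ> (G \<circ> F) \<circ> inv_into U \<phi>) w) (nhds (\<phi> p))"
      by eventually_elim (use chX(3) chY(3) in auto)
    then show ?thesis
      using an analytic_at_cong by blast
  qed
  then have "(\<xi> \<circ> (G \<circ> F) \<circ> inv_into U \<phi>) analytic_on \<phi> ` (U \<inter> (G \<circ> F) -` W)"
    by (subst analytic_on_analytic_at) auto
  then show "(\<xi> \<circ> (G \<circ> F) \<circ> inv_into U \<phi>) holomorphic_on \<phi> ` (U \<inter> (G \<circ> F) -` W)"
    by (rule analytic_imp_holomorphic)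
qed

text \<open>The order of \<open>k \<circ> F\<close> at \<open>p\<close> equals that of \<open>k\<close> at \<open>F p\<close>, whatever charts are used: in charts,
  the two functions differ by composition with an injective holomorphic map.\<close>

lemma zorder_pullback:
  assumes X: "riemann_surface X A" and Y: "riemann_surface Y B"
    and F: "holomorphic_map X A Y B F" "inj_on F (topspace X)"
    and charts: "(U, \<phi>) \<in> A" "(V, \<psi>) \<in> B" and p: "p \<in> U" "F p \<in> V"
    and mero: "(k \<circ> inv_into V \<psi>) meromorphic_on {\<psi> (F p)}"
  shows "zorder (k \<circ> F \<circ> inv_into U \<phi>) (\<phi> p) = zorder (k \<circ> inv_into V \<psi>) (\<psi> (F p))"
proof -
  note chX = complex_chartD[OF riemann_surface_chart(1)[OF X charts(1)]]
  note chY = complex_chartD[OF riemann_surface_chart(1)[OF Y charts(2)]]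
  let ?S = "\<phi> ` (U \<inter> F -` V)" and ?t = "\<psi> \<circ> F \<circ> inv_into U \<phi>"
  note t = holomorphic_map_in_charts[OF X Y F(1) charts]
  have "inj_on ?t ?S"
  proof (rule inj_onI)
    fix a b assume "a \<in> ?S" "b \<in> ?S" "?t a = ?t b"
    then obtain x y where xy: "x \<in> U" "F x \<in> V" "a = \<phi> x" "y \<in> U" "F y \<in> V" "b = \<phi> y"
      by blast
    then have "\<psi> (F x) = \<psi> (F y)"
      using \<open>?t a = ?t b\<close> chX(3) by simp
    then have "F x = F y"
      using inj_onD[OF chY(3)] xy by blast
    then have "x = y"
      using inj_onD[OF F(2)] xy chX(2) by blast
    then show "a = b" using xy by simp
  qed
  moreover have "\<phi> p \<in> ?S" using p by blast
  moreover have tp: "?t (\<phi> p) = \<psi> (F p)"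
    using chX(3) p by simp
  ultimately have "zorder ((k \<circ> inv_into V \<psi>) \<circ> ?t) (\<phi> p) = zorder (k \<circ> inv_into V \<psi>) (?t (\<phi> p))"
    using t mero by (intro zorder_compose_injective[of _ _ _ ?S]) simp_all
  moreover have "zorder (k \<circ> F \<circ> inv_into U \<phi>) (\<phi> p) = zorder ((k \<circ> inv_into V \<psi>) \<circ> ?t) (\<phi> p)"
  proof (rule zorder_cong)
    have "eventually (\<lambda>w. w \<in> ?S) (at (\<phi> p))"
      using t(1) \<open>\<phi> p \<in> ?S\<close> by (rule eventually_at_in_open')
    then show "eventually (\<lambda>w. (k \<circ> F \<circ> inv_into U \<phi>) w = (k \<circ> inv_into V \<psi> \<circ> ?t) w) (at (\<phi> p))"
      by eventually_elim (use chX(3) chY(3) in auto)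
  qed simp
  ultimately show ?thesis
    using tp by simp
qed

section \<open>Meromorphic functions on Riemann surfaces\<close>

text \<open>The finite part of a point of the sphere, with value \<open>0\<close> at infinity.  With this choice,
  \<open>inverse (affine_value x)\<close> is the coordinate at infinity for all \<open>x\<close> other than \<open>Some 0\<close>, without
  an exception at infinity; \<open>affine_value \<circ> f\<close> is then meromorphic in charts even if \<open>f\<close> is
  infinite on an open set.\<close>

definition affine_value :: "complex option \<Rightarrow> complex" where
  "affine_value = case_option 0 id"

lemma affine_value_simps [simp]: "affine_value None = 0" "affine_value (Some z) = z"
  by (simp_all add: affine_value_def)

lemma analytic_affine_value:
  assumes X: "riemann_surface X A" and f: "holomorphic_map X A riemann_sphere riemann_sphere_atlas f"
    and c: "(U, \<phi>) \<in> A" "p \<in> U"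
  shows "f p \<noteq> None \<Longrightarrow> (affine_value \<circ> f \<circ> inv_into U \<phi>) analytic_on {\<phi> p}"
    and "f p \<noteq> Some 0 \<Longrightarrow> (\<lambda>w. inverse ((affine_value \<circ> f \<circ> inv_into U \<phi>) w)) analytic_on {\<phi> p}"
proof -
  note chX = complex_chartD[OF riemann_surface_chart(1)[OF X c(1)]]
  have an: "g analytic_on {\<phi> p}"
    if V: "(V, \<psi>) \<in> riemann_sphere_atlas" "f p \<in> V"
      and eq: "\<And>x. x \<in> U \<Longrightarrow> f x \<in> V \<Longrightarrow> \<psi> (f x) = g (\<phi> x)" for V \<psi> g
  proof -
    note h = holomorphic_map_in_charts[OF X riemann_surface_riemann_sphere f c(1) V(1)]
    have "g holomorphic_on \<phi> ` (U \<inter> f -` V)"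
      by (rule holomorphic_transform[OF h(2)]) (use eq chX(3) in auto)
    then show ?thesis
      using h(1) c V(2) analytic_at by blast
  qed
  show "(affine_value \<circ> f \<circ> inv_into U \<phi>) analytic_on {\<phi> p}" if "f p \<noteq> None"
    by (rule an[of "range Some" "the"])
      (use that chX(3) in \<open>auto simp: riemann_sphere_atlas_def\<close>)
  show "(\<lambda>w. inverse ((affine_value \<circ> f \<circ> inv_into U \<phi>) w)) analytic_on {\<phi> p}" if "f p \<noteq> Some 0"
    by (rule an[of "UNIV - {Some 0}" "case_option 0 inverse"])
      (use that chX(3) in \<open>auto simp: riemann_sphere_atlas_def split: option.splits\<close>)
qed

lemma meromorphic_affine_value:
  assumes X: "riemann_surface X A" and f: "holomorphic_map X A riemann_sphere riemann_sphere_atlas f"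
    and c: "(U, \<phi>) \<in> A"
  shows "(affine_value \<circ> f \<circ> inv_into U \<phi>) meromorphic_on \<phi> ` U"
proof -
  let ?k = "affine_value \<circ> f \<circ> inv_into U \<phi>"
  have "?k meromorphic_on {\<phi> p}" if "p \<in> U" for p
  proof (cases "f p = None")
    case False
    then show ?thesis
      using analytic_affine_value(1)[OF X f c that] analytic_on_imp_meromorphic_on by blast
  next
    case True
    then have "(\<lambda>w. inverse (?k w)) meromorphic_on {\<phi> p}"
      using analytic_affine_value(2)[OF X f c that] analytic_on_imp_meromorphic_on by simp
    then have "(\<lambda>w. inverse (inverse (?k w))) meromorphic_on {\<phi> p}"
      by (rule meromorphic_on_inverse)
    then show ?thesis by (simp add: comp_def)
  qed
  then show ?thesis
    by (subst meromorphic_on_meromorphic_at) auto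
qed

text \<open>At a pole, this is obtained from the zero of the reciprocal.  The reciprocal can be used
  because \<open>f\<close> is neither \<open>0\<close> nor infinite near \<open>p\<close>, except possibly at \<open>p\<close>.\<close>

lemma zorder_affine_value_sign:
  assumes X: "riemann_surface X A" and f: "holomorphic_map X A riemann_sphere riemann_sphere_atlas f"
    and c: "(U, \<phi>) \<in> A" "p \<in> U"
    and nz: "eventually (\<lambda>w. (affine_value \<circ> f \<circ> inv_into U \<phi>) w \<noteq> 0) (at (\<phi> p))"
  shows "zorder (affine_value \<circ> f \<circ> inv_into U \<phi>) (\<phi> p) > 0 \<longleftrightarrow> f p = Some 0"
    and "zorder (affine_value \<circ> f \<circ> inv_into U \<phi>) (\<phi> p) < 0 \<longleftrightarrow> f p = None"
proof -
  note chX = complex_chartD[OF riemann_surface_chart(1)[OF X c(1)]]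
  define k where "k = affine_value \<circ> f \<circ> inv_into U \<phi>"
  define l where "l = (\<lambda>w. inverse (k w))"
  have kp: "k (\<phi> p) = affine_value (f p)"
    using chX(3) c(2) by (simp add: k_def)
  have k: "k analytic_on {\<phi> p}" if "f p \<noteq> None"
    using analytic_affine_value(1)[OF X f c that] by (simp add: k_def)
  have l: "l analytic_on {\<phi> p}" if "f p = None"
    using analytic_affine_value(2)[OF X f c] that by (simp add: k_def l_def)
  have freq: "frequently (\<lambda>w. k w \<noteq> 0) (at (\<phi> p))" "frequently (\<lambda>w. l w \<noteq> 0) (at (\<phi> p))"
    using nz by (simp_all add: eventually_frequently k_def l_def)
  have "k meromorphic_on {\<phi> p}"
    using meromorphic_affine_value[OF X f c(1)] c(2) meromorphic_on_subset unfolding k_def by blast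
  then have inv: "zorder l (\<phi> p) = - zorder k (\<phi> p)"
    using freq(1) unfolding meromorphic_at_iff l_def by (elim conjE) (rule zorder_inverse)
  have fin: "zorder k (\<phi> p) \<ge> 0" "zorder k (\<phi> p) = 0 \<longleftrightarrow> f p \<noteq> Some 0" if "f p \<noteq> None"
    using zorder_ge_0[OF k[OF that] freq(1)] zorder_eq_0_iff[OF k[OF that] freq(1)] that kp
    by auto
  have inf: "zorder k (\<phi> p) < 0" if "f p = None"
    using zorder_pos_iff'[OF l[OF that] freq(2)] that kp inv by (simp add: l_def)
  have "zorder k (\<phi> p) > 0 \<longleftrightarrow> f p = Some 0" "zorder k (\<phi> p) < 0 \<longleftrightarrow> f p = None"
    using fin inf by force+
  then show "zorder (affine_value \<circ> f \<circ> inv_into U \<phi>) (\<phi> p) > 0 \<longleftrightarrow> f p = Some 0"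
    and "zorder (affine_value \<circ> f \<circ> inv_into U \<phi>) (\<phi> p) < 0 \<longleftrightarrow> f p = None"
    by (simp_all add: k_def)
qed

text \<open>The order of \<open>f\<close> on \<open>X\<close> may be computed on an isomorphic surface \<open>Y\<close>, in any chart there.
  Since the right-hand side does not involve a chart of \<open>X\<close>, this includes that the definite
  description in the definition of the order is satisfied.  The finiteness of the poles is used to
  replace \<open>the\<close>, which is unspecified at infinity, by \<open>affine_value\<close> near \<open>p\<close>.\<close>

lemma meromorphic_order_eq_zorder:
  assumes X: "riemann_surface X A" and Y: "riemann_surface Y B"
    and F: "holomorphic_map X A Y B F" and G: "holomorphic_map Y B X A G"
    and inverses: "\<And>x. x \<in> topspace X \<Longrightarrow> G (F x) = x" "\<And>y. y \<in> topspace Y \<Longrightarrow> F (G y) = y"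
    and f: "holomorphic_map X A riemann_sphere riemann_sphere_atlas f" "finite (poles X f)"
    and p: "p \<in> topspace X" and V: "(V, \<psi>) \<in> B" "F p \<in> V"
  shows "meromorphic_order A f p
    = zorder (affine_value \<circ> (f \<circ> G) \<circ> inv_into V \<psi>) (\<psi> (F p))"
proof -
  let ?n = "zorder (affine_value \<circ> (f \<circ> G) \<circ> inv_into V \<psi>) (\<psi> (F p))"
  have eq: "zorder (the \<circ> f \<circ> inv_into U \<phi>) (\<phi> p) = ?n" if c: "(U, \<phi>) \<in> A" "p \<in> U" for U \<phi>
  proof -
    note chX = complex_chartD[OF riemann_surface_chart(1)[OF X c(1)]]
    have "closedin X (poles X f - {p})"
    proof (rule closedin_Hausdorff_finite)
      show "Hausdorff_space X" using X by (simp add: riemann_surface_def)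
    qed (use f(2) in \<open>auto simp: poles_def\<close>)
    then have "openin X (U - (poles X f - {p}))"
      by (rule openin_diff[OF chX(1)])
    then have "open (\<phi> ` (U - (poles X f - {p})))"
      using chX(4) by blast
    then have "eventually (\<lambda>w. w \<in> \<phi> ` (U - (poles X f - {p})) - {\<phi> p}) (at (\<phi> p))"
      using c by (intro eventually_at_in_open) auto
    then have "eventually (\<lambda>w. (the \<circ> f \<circ> inv_into U \<phi>) w
        = (affine_value \<circ> f \<circ> inv_into U \<phi>) w) (at (\<phi> p))"
    proof eventually_elim
      case (elim w)
      then obtain x where x: "x \<in> U" "x \<notin> poles X f" "w = \<phi> x"
        by blast
      then have "f x \<noteq> None"
        using chX(2) by (auto simp: poles_def)
      then show ?case
        using x chX(3) by auto
    qed
    then have "zorder (the \<circ> f \<circ> inv_into U \<phi>) (\<phi> p)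
        = zorder (affine_value \<circ> f \<circ> inv_into U \<phi>) (\<phi> p)"
      by (rule zorder_cong) simp
    also have "\<dots> = ?n"
    proof -
      have "inj_on G (topspace Y)"
        using inverses(2) by (rule inj_on_inverseI)
      moreover have "G (F p) = p" using inverses(1) p .
      moreover have "(affine_value \<circ> f \<circ> inv_into U \<phi>) meromorphic_on {\<phi> p}"
        using meromorphic_affine_value[OF X f(1) c(1)] c(2) meromorphic_on_subset by blast
      ultimately show ?thesis
        using zorder_pullback[OF Y X G _ V(1) c(1) V(2), of "affine_value \<circ> f"] c(2)
        by (simp add: comp_assoc)
    qed
    finally show ?thesis .
  qed
  obtain U \<phi> where "(U, \<phi>) \<in> A" "p \<in> U"
    using riemann_surface_chart(2)[OF X p] by blast
  then show ?thesis
    unfolding meromorphic_order_def using eq by (intro the_equality) force+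
qed

section \<open>Meromorphic functions on the sphere\<close>

lemma inv_into_sphere_charts:
  "inv_into (range Some) (the :: complex option \<Rightarrow> complex) = Some"
  "inv_into (UNIV - {Some 0}) (case_option 0 inverse)
    = (\<lambda>w :: complex. if w = 0 then None else Some (inverse w))"
proof -
  show "inv_into (range Some) (the :: complex option \<Rightarrow> complex) = Some"
    by (rule ext, rule inv_into_f_eq) (auto simp: inj_on_def)
  have "inj_on (case_option 0 inverse) (UNIV - {Some (0 :: complex)})"
    by (auto simp: inj_on_def split: option.splits)
  then show "inv_into (UNIV - {Some 0}) (case_option 0 inverse)
    = (\<lambda>w :: complex. if w = 0 then None else Some (inverse w))"
    by (intro ext inv_into_f_eq) auto
qed

text \<open>The order at a point of the sphere, in the coordinate \<open>z\<close> at finite points and in the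
  coordinate \<open>1 / z\<close> at infinity.\<close>

definition sphere_order :: "(complex option \<Rightarrow> complex option) \<Rightarrow> complex option \<Rightarrow> int" where
  "sphere_order f q = (case q of
     Some z \<Rightarrow> zorder (affine_value \<circ> f \<circ> Some) z
   | None \<Rightarrow> zorder (affine_value \<circ> f \<circ> (\<lambda>w. if w = 0 then None else Some (inverse w))) 0)"

lemma constant_if_finite_image:
  assumes "connected_space X" "Hausdorff_space Y" "continuous_map X Y f" "finite (f ` topspace X)"
  shows "f constant_on topspace X"
proof -
  have "connectedin Y (f ` topspace X)"
    using assms connectedin_continuous_map_image connectedin_topspace by blast
  then have "connected_space (subtopology Y (f ` topspace X))" "f ` topspace X \<subseteq> topspace Y"
    by (simp_all add: connectedin_def)
  moreover have "subtopology Y (f ` topspace X) = discrete_topology (f ` topspace X)"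
    using assms calculation(2)
    by (intro subtopology_eq_discrete_topology_finite Hausdorff_imp_t1_space) auto
  ultimately obtain a where "f ` topspace X \<subseteq> {a}"
    by (auto simp: connected_space_discrete_topology)
  then have "\<forall>x\<in>topspace X. f x = a" by blast
  then show ?thesis
    unfolding constant_on_def ..
qed

text \<open>Otherwise the identity theorem leaves \<open>f\<close> with at most three values on the sphere, namely
  infinity, \<open>0\<close> and its value at infinity; but a continuous function with finitely many values on
  a connected space is constant.\<close>

lemma sphere_affine_value_nonzero:
  assumes f: "holomorphic_map riemann_sphere riemann_sphere_atlas riemann_sphere riemann_sphere_atlas f"
    and nc: "\<not> f constant_on UNIV"
  shows "\<forall>\<^sub>\<approx>z\<in>UNIV. (affine_value \<circ> f \<circ> Some) z \<noteq> 0"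
proof (rule ccontr)
  let ?k = "affine_value \<circ> f \<circ> Some"
  note S = riemann_surface_riemann_sphere
  have chart: "(range Some, the) \<in> riemann_sphere_atlas"
    by (simp add: riemann_sphere_atlas_def)
  have "?k meromorphic_on UNIV"
    using meromorphic_affine_value[OF S f chart] by (simp add: inv_into_sphere_charts image_image)
  moreover assume "\<not> (\<forall>\<^sub>\<approx>z\<in>UNIV. ?k z \<noteq> 0)"
  ultimately have "\<forall>\<^sub>\<approx>z\<in>UNIV. ?k z = 0"
    using meromorphic_imp_constant_or_avoid[of ?k UNIV 0] by auto
  then have zero: "eventually (\<lambda>w. ?k w = 0) (at z)" for z
    by (simp add: eventually_cosparse_open_eq)
  have "f (Some z) \<in> {None, Some 0}" for z
  proof (cases "f (Some z) = None")
    case False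
    then have "?k analytic_on {z}"
      using analytic_affine_value(1)[OF S f chart, of "Some z"] by (simp add: inv_into_sphere_charts)
    then have "?k \<midarrow>z\<rightarrow> ?k z"
      using analytic_at_imp_isCont isContD by blast
    moreover have "?k \<midarrow>z\<rightarrow> 0"
      using zero by (rule tendsto_eventually)
    ultimately have "?k z = 0"
      using LIM_unique by blast
    with False show ?thesis by auto
  qed simp
  then have "f q \<in> {None, Some 0, f None}" for q
    by (cases q) (simp, metis insertCI insertE singletonD)
  then have "range f \<subseteq> {None, Some 0, f None}" by (rule image_subsetI)
  then have "finite (range f)"
    by (rule finite_subset) simp
  then have "f constant_on topspace riemann_sphere"
    using S f
    by (intro constant_if_finite_image[of _ riemann_sphere])
      (simp_all add: riemann_surface_def holomorphic_map_def)
  with nc show False by simp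
qed

text \<open>The orders of a non-constant meromorphic function on the sphere detect its zeros and poles,
  and add up to zero.\<close>

theorem sphere_order_sum:
  assumes f: "holomorphic_map riemann_sphere riemann_sphere_atlas riemann_sphere riemann_sphere_atlas f"
    and nc: "\<not> f constant_on UNIV"
  shows "sphere_order f q > 0 \<longleftrightarrow> f q = Some 0" "sphere_order f q < 0 \<longleftrightarrow> f q = None"
    and "finite {q. sphere_order f q \<noteq> 0}"
    and "(\<Sum>q | sphere_order f q \<noteq> 0. sphere_order f q) = 0"
proof -
  let ?k = "affine_value \<circ> f \<circ> Some"
  let ?\<iota> = "\<lambda>w :: complex. if w = 0 then None else Some (inverse w)"
  let ?K = "affine_value \<circ> f \<circ> ?\<iota>"
  note S = riemann_surface_riemann_sphere
  have charts: "(range Some, the) \<in> riemann_sphere_atlas"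
    "(UNIV - {Some 0}, case_option 0 inverse) \<in> riemann_sphere_atlas"
    by (simp_all add: riemann_sphere_atlas_def)
  note nz = sphere_affine_value_nonzero[OF f nc]
  have mero: "?k meromorphic_on UNIV"
    using meromorphic_affine_value[OF S f charts(1)] by (simp add: inv_into_sphere_charts image_image)
  have "None \<in> UNIV - {Some (0 :: complex)}" by simp
  then have "{0} \<subseteq> case_option 0 inverse ` (UNIV - {Some (0 :: complex)})"
    by force
  then have K: "?K meromorphic_on {0}"
    using meromorphic_affine_value[OF S f charts(2)] meromorphic_on_subset
    unfolding inv_into_sphere_charts by blast
  have Kk: "eventually (\<lambda>w. ?K w = ?k (inverse w)) (at z)" if "z \<in> {0}" for z
    using that by (auto simp: eventually_at_filter)
  have inf: "(\<lambda>w. ?k (inverse w)) meromorphic_on {0}"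
    by (rule iffD1[OF meromorphic_on_cong[OF Kk refl] K])
  have order_None: "sphere_order f None = zorder (\<lambda>w. ?k (inverse w)) 0"
    unfolding sphere_order_def option.case by (rule zorder_cong[OF Kk]) simp_all
  have order_Some: "sphere_order f (Some z) = zorder ?k z" for z
    by (simp add: sphere_order_def)
  have K_nz: "eventually (\<lambda>w. ?K w \<noteq> 0) (at 0)"
  proof -
    have "eventually (\<lambda>w. ?k (inverse w) \<noteq> 0) (at 0)"
      using eventually_nonzero_at_infinity[OF mero inf nz]
      unfolding eventually_at_infinity_inverse .
    with Kk[OF singletonI] show ?thesis
      by eventually_elim simp
  qed
  have k_nz: "eventually (\<lambda>w. ?k w \<noteq> 0) (at z)" for z
    using nz by (simp add: eventually_cosparse_open_eq)
  show "sphere_order f q > 0 \<longleftrightarrow> f q = Some 0" "sphere_order f q < 0 \<longleftrightarrow> f q = None"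
  proof (atomize (full), cases q)
    case None
    show "(sphere_order f q > 0 \<longleftrightarrow> f q = Some 0) \<and> (sphere_order f q < 0 \<longleftrightarrow> f q = None)"
      using zorder_affine_value_sign[OF S f charts(2), of None] K_nz None
      by (simp add: inv_into_sphere_charts sphere_order_def)
  next
    case (Some z)
    show "(sphere_order f q > 0 \<longleftrightarrow> f q = Some 0) \<and> (sphere_order f q < 0 \<longleftrightarrow> f q = None)"
      using zorder_affine_value_sign[OF S f charts(1), of "Some z"] k_nz[of z] Some
      by (simp add: inv_into_sphere_charts sphere_order_def)
  qed
  let ?T = "{z. zorder ?k z \<noteq> 0}"
  have fin: "finite ?T"
    by (rule finite_zorder_nonzero[OF mero inf nz])
  have sub: "{q. sphere_order f q \<noteq> 0} \<subseteq> insert None (Some ` ?T)"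
  proof
    fix q assume "q \<in> {q. sphere_order f q \<noteq> 0}"
    then show "q \<in> insert None (Some ` ?T)"
      by (cases q) (auto simp: order_Some)
  qed
  then show "finite {q. sphere_order f q \<noteq> 0}"
    using fin finite_subset by blast
  have "(\<Sum>q | sphere_order f q \<noteq> 0. sphere_order f q)
      = (\<Sum>q\<in>insert None (Some ` ?T). sphere_order f q)"
    using sub fin by (intro sum.mono_neutral_left) auto
  also have "\<dots> = zorder (\<lambda>w. ?k (inverse w)) 0 + (\<Sum>z\<in>?T. zorder ?k z)"
    using fin by (simp add: order_None order_Some sum.reindex image_iff)
  also have "\<dots> = 0"
    using sum_zorder_extended_plane[OF mero inf nz] by linarith
  finally show "(\<Sum>q | sphere_order f q \<noteq> 0. sphere_order f q) = 0" .
qed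

lemma sum_nat_eq_sum_nat_uminus:
  fixes n :: "'a \<Rightarrow> int"
  assumes "finite {q. n q \<noteq> 0}" "(\<Sum>q | n q \<noteq> 0. n q) = 0"
  shows "(\<Sum>q | n q > 0. nat (n q)) = (\<Sum>q | n q < 0. nat (- n q))"
proof -
  have split: "{q. n q \<noteq> 0} = {q. n q > 0} \<union> {q. n q < 0}" by auto
  then have fin: "finite {q. n q > 0}" "finite {q. n q < 0}"
    using assms(1) by (metis finite_Un)+
  have "(\<Sum>q | n q \<noteq> 0. n q) = (\<Sum>q | n q > 0. n q) + (\<Sum>q | n q < 0. n q)"
    unfolding split using fin by (rule sum.union_disjoint) auto
  then have "(\<Sum>q | n q > 0. n q) = (\<Sum>q | n q < 0. - n q)"
    using assms(2) by (simp add: sum_negf)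
  moreover have "int (\<Sum>q | n q > 0. nat (n q)) = (\<Sum>q | n q > 0. n q)"
    "int (\<Sum>q | n q < 0. nat (- n q)) = (\<Sum>q | n q < 0. - n q)"
    unfolding of_nat_sum by (rule sum.cong; simp)+
  ultimately show ?thesis by linarith
qed

section \<open>Zeros and poles on surfaces isomorphic to the sphere\<close>

theorem theorem10p2:
  fixes X :: "'a topology" and A :: "'a chart set" and f :: "'a \<Rightarrow> complex option"
  assumes "riemann_surface X A" and "compact_space X" and "has_genus X 0"
    and "biholomorphic X A riemann_sphere riemann_sphere_atlas"
    and "meromorphic_function X A f" and "\<not> f constant_on topspace X"
  shows "finite (zeros X f) \<and> finite (poles X f) \<and>
    (\<Sum>p\<in>zeros X f. zero_multiplicity A f p) = (\<Sum>p\<in>poles X f. pole_multiplicity A f p)"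
proof -
  note X = assms(1) and S = riemann_surface_riemann_sphere
  have f: "holomorphic_map X A riemann_sphere riemann_sphere_atlas f"
    using assms(5) by (simp add: meromorphic_function_def)
  obtain F G where F: "holomorphic_map X A riemann_sphere riemann_sphere_atlas F"
    and G: "holomorphic_map riemann_sphere riemann_sphere_atlas X A G"
    and GF: "\<And>x. x \<in> topspace X \<Longrightarrow> G (F x) = x" and FG: "\<And>y. F (G y) = y"
    using assms(4) by (auto simp: biholomorphic_def)
  have G_in: "G y \<in> topspace X" for y
    using G by (auto simp: holomorphic_map_def continuous_map_def)
  define n where "n = sphere_order (f \<circ> G)"
  have fG: "holomorphic_map riemann_sphere riemann_sphere_atlas riemann_sphere riemann_sphere_atlas (f \<circ> G)"
    by (rule holomorphic_map_compose[OF S X S G f])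
  have "\<not> (f \<circ> G) constant_on UNIV"
  proof
    assume "(f \<circ> G) constant_on UNIV"
    then obtain c where "\<And>y. f (G y) = c"
      by (auto simp: constant_on_def)
    then have "f x = c" if "x \<in> topspace X" for x
      using GF[OF that] by metis
    then show False
      using assms(6) by (auto simp: constant_on_def)
  qed
  note n = sphere_order_sum[OF fG this, folded n_def]
  have zeros: "bij_betw G {q. n q > 0} (zeros X f)"
    by (rule bij_betw_byWitness[of _ F]) (auto simp: n zeros_def GF FG G_in)
  have poles: "bij_betw G {q. n q < 0} (poles X f)"
    by (rule bij_betw_byWitness[of _ F]) (auto simp: n poles_def GF FG G_in)
  have "finite {q. n q > 0}" "finite {q. n q < 0}"
    by (rule finite_subset[OF _ n(3)], force)+
  then have fin: "finite (zeros X f)" "finite (poles X f)"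
    using zeros poles bij_betw_finite by blast+
  have order: "meromorphic_order A f (G q) = n q" for q
  proof -
    note eq = meromorphic_order_eq_zorder[OF X S F G GF FG f fin(2) G_in]
    show ?thesis
    proof (cases q)
      case None
      then show ?thesis
        using eq[of "UNIV - {Some 0}" "case_option 0 inverse" q]
        by (simp add: n_def FG riemann_sphere_atlas_def inv_into_sphere_charts sphere_order_def)
    next
      case (Some z)
      then show ?thesis
        using eq[of "range Some" the q]
        by (simp add: n_def FG riemann_sphere_atlas_def inv_into_sphere_charts sphere_order_def)
    qed
  qed
  have "(\<Sum>p\<in>zeros X f. zero_multiplicity A f p) = (\<Sum>q | n q > 0. nat (n q))"
    by (simp add: sum.reindex_bij_betw[OF zeros, symmetric] zero_multiplicity_def order)
  also have "\<dots> = (\<Sum>q | n q < 0. nat (- n q))"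
    by (rule sum_nat_eq_sum_nat_uminus[OF n(3,4)])
  also have "\<dots> = (\<Sum>p\<in>poles X f. pole_multiplicity A f p)"
    by (simp add: sum.reindex_bij_betw[OF poles, symmetric] pole_multiplicity_def order)
  finally show ?thesis
    using fin by blast
qed

end
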